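(* Let $k\ge1$, let $H$ be a $2k$-meager hypergraph, let $X$ be a vertex set of cardinality $<k$, let $z_0$ be a vertex not in $\overline{X}$, and put $Y=\overline{X}\cup\{z_0\}$, $Z=\overline{Y}$, $p=\|Z\setminus Y\|$. Then $p<k$ and there is an ordering $z_1,\dots,z_p$ of $Z\setminus Y$ such that for every $j$ with $1\le j\le p$, $z_j$ is attracted by $Y\cup\{z_i:1\leq i<j\}$, and there is a unique hyperedge witnessing this attraction (i.e. a unique hyperedge $h$ with $z_j\in h$ and $h\setminus\{z_j\}\subseteq Y\cup\{z_i:1\le i<j\}$).
   Context: A hypergraph is a pair $H=(U,T)$ with $U$ a finite nonempty vertex set and $T$ a collection of 3-element subsets of $U$ (hyperedges). For nonempty $X\subseteq U$, $\|X\|$ is its cardinality and $[X]$ the number of hyperedges contained in $X$; $X$ is dense if $\|X\|\le2[X]$; $H$ is $l$-meager if it has no dense vertex sets of cardinality $\le 2l$. A vertex set $X$ attracts a vertex $y$ if there are $x_1,x_2\in X$ with $\{x_1,x_2,y\}\in T$; such a hyperedge witnesses the attraction. $X$ is closed if it contains every vertex it attracts; the closure $\overline{X}$ is the least closed set containing $X$. *)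

theory Defs
  imports Main "HOL.Hull"
begin

definition hypergraph :: "'a set \<Rightarrow> 'a set set \<Rightarrow> bool" where
  "hypergraph U T \<longleftrightarrow> finite U \<and> U \<noteq> {} \<and> (\<forall>h\<in>T. h \<subseteq> U \<and> card h = 3)"

definition num_edges :: "'a set set \<Rightarrow> 'a set \<Rightarrow> nat" where
  "num_edges T X = card {h \<in> T. h \<subseteq> X}"

text \<open>Density concerns nonempty vertex sets only; the inequality alone would
  make the empty set dense, and then no hypergraph would be meager.\<close>

definition dense_set :: "'a set \<Rightarrow> 'a set set \<Rightarrow> 'a set \<Rightarrow> bool" where
  "dense_set U T X \<longleftrightarrow> X \<subseteq> U \<and> X \<noteq> {} \<and> card X \<le> 2 * num_edges T X"

definition meager :: "nat \<Rightarrow> 'a set \<Rightarrow> 'a set set \<Rightarrow> bool" where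
  "meager l U T \<longleftrightarrow> \<not> (\<exists>X. dense_set U T X \<and> card X \<le> 2 * l)"

definition witnesses :: "'a set set \<Rightarrow> 'a set \<Rightarrow> 'a \<Rightarrow> 'a set \<Rightarrow> bool" where
  "witnesses T X y h \<longleftrightarrow> h \<in> T \<and> (\<exists>x1\<in>X. \<exists>x2\<in>X. h = {x1, x2, y})"

definition attracts :: "'a set set \<Rightarrow> 'a set \<Rightarrow> 'a \<Rightarrow> bool" where
  "attracts T X y \<longleftrightarrow> (\<exists>x1\<in>X. \<exists>x2\<in>X. {x1, x2, y} \<in> T)"

definition closed_set :: "'a set \<Rightarrow> 'a set set \<Rightarrow> 'a set \<Rightarrow> bool" where
  "closed_set U T X \<longleftrightarrow> X \<subseteq> U \<and> (\<forall>y\<in>U. attracts T X y \<longrightarrow> y \<in> X)"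

definition hclosure :: "'a set \<Rightarrow> 'a set set \<Rightarrow> 'a set \<Rightarrow> 'a set" where
  "hclosure U T X = closed_set U T hull X"

text \<open>The intersection defining the hull is over a nonempty family when \<open>X \<subseteq> U\<close>,
  since \<open>U\<close> is closed, and it is the least closed superset of \<open>X\<close>.\<close>

lemma hclosure_least:
  assumes "X \<subseteq> U"
  shows "closed_set U T (hclosure U T X)" and "X \<subseteq> hclosure U T X"
    and "\<And>C. closed_set U T C \<Longrightarrow> X \<subseteq> C \<Longrightarrow> hclosure U T X \<subseteq> C"
proof -
  have "closed_set U T U" by (simp add: closed_set_def)
  then have "hclosure U T X \<subseteq> U"
    using assms unfolding hclosure_def by (rule hull_minimal[rotated])
  moreover have "y \<in> hclosure U T X" if y: "y \<in> U" "attracts T (hclosure U T X) y" for y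
    unfolding hclosure_def hull_def
  proof (rule InterI, clarify)
    fix C assume C: "closed_set U T C" "X \<subseteq> C"
    then have "hclosure U T X \<subseteq> C" unfolding hclosure_def by (rule hull_minimal[rotated])
    then have "attracts T C y" using y(2) unfolding attracts_def by blast
    then show "y \<in> C" using C(1) y(1) unfolding closed_set_def by blast
  qed
  ultimately show "closed_set U T (hclosure U T X)" by (simp add: closed_set_def)
  show "X \<subseteq> hclosure U T X" unfolding hclosure_def by (rule hull_subset)
  show "\<And>C. closed_set U T C \<Longrightarrow> X \<subseteq> C \<Longrightarrow> hclosure U T X \<subseteq> C"
    unfolding hclosure_def by (rule hull_minimal)
qed

lemma attracts_iff_witnesses: "attracts T X y \<longleftrightarrow> (\<exists>h. witnesses T X y h)"
  by (auto simp: attracts_def witnesses_def)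

lemma witnesses_iff:
  assumes "hypergraph U T"
  shows "witnesses T X y h \<longleftrightarrow> h \<in> T \<and> y \<in> h \<and> h - {y} \<subseteq> X"
proof
  assume "witnesses T X y h"
  then show "h \<in> T \<and> y \<in> h \<and> h - {y} \<subseteq> X" by (auto simp: witnesses_def)
next
  assume a: "h \<in> T \<and> y \<in> h \<and> h - {y} \<subseteq> X"
  then have "card h = 3" using assms by (auto simp: hypergraph_def)
  then have "card (h - {y}) = 2" using a by simp
  then obtain x1 x2 where x: "h - {y} = {x1, x2}" unfolding card_2_iff by blast
  then have "x1 \<in> X" "x2 \<in> X" using a by blast+
  moreover have "h = {x1, x2, y}" using x a by blast
  ultimately show "witnesses T X y h" using a unfolding witnesses_def by blast
qed

end

theory Submission
  imports Defs
begin

text \<open>Each vertex added while generating a closure brings a new hyperedge, so a nonempty set of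
  \<open>m \<le> 2 k\<close> vertices has a closure of fewer than \<open>2 m\<close> vertices; otherwise the first
  \<open>m\<close> steps produce a dense set. Applied to \<open>X \<union> {z0}\<close> this gives \<open>p < k\<close>. For uniqueness, every
  hyperedge that is not contained in a closed set \<open>C\<close> has at most one vertex in \<open>C\<close>, so \<open>v\<close>
  such hyperedges inside \<open>C \<union> V\<close>, where \<open>card V = v\<close>, span together with \<open>V\<close> at most \<open>2 v\<close>
  vertices, a dense set. A second witness at step \<open>j\<close> would produce \<open>j + 1\<close> such hyperedges
  for \<open>V = {z0, \<dots>, zj}\<close>.\<close>

lemma hypergraph_finite_edges: "hypergraph U T \<Longrightarrow> finite T"
  unfolding hypergraph_def by (meson PowI finite_Pow_iff finite_subset subsetI)

lemma num_edges_mono: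
  assumes "finite T" "A \<subseteq> B"
  shows "num_edges T A \<le> num_edges T B"
  unfolding num_edges_def using assms by (intro card_mono) auto

text \<open>The hyperedges gained with \<open>y\<close> contain \<open>y\<close> and have their
  other two vertices in \<open>S\<close>, so they are its witnesses. Equality, rather than a lower
  bound, lets an edge count limit the number of witnesses.\<close>

lemma num_edges_insert:
  assumes H: "hypergraph U T" and y: "y \<notin> S"
  shows "num_edges T (insert y S) = num_edges T S + card {h. witnesses T S y h}"
proof -
  have T: "finite T" using H by (rule hypergraph_finite_edges)
  have W: "{h. witnesses T S y h} = {h \<in> T. y \<in> h \<and> h - {y} \<subseteq> S}"
    using witnesses_iff[OF H] by blast
  have "{h \<in> T. h \<subseteq> insert y S} = {h \<in> T. h \<subseteq> S} \<union> {h. witnesses T S y h}"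
    unfolding W using y by auto
  moreover have "{h \<in> T. h \<subseteq> S} \<inter> {h. witnesses T S y h} = {}"
    unfolding W using y by auto
  moreover have "finite {h. witnesses T S y h}" unfolding W using T by simp
  ultimately show ?thesis
    unfolding num_edges_def using T by (simp add: card_Un_disjoint)
qed

lemma finite_witnesses:
  assumes "hypergraph U T"
  shows "finite {h. witnesses T S y h}"
  using hypergraph_finite_edges[OF assms] by (rule rev_finite_subset) (auto simp: witnesses_def)

lemma hclosure_subset: "X \<subseteq> U \<Longrightarrow> hclosure U T X \<subseteq> U"
  using hclosure_least(1)[of X U T] by (simp add: closed_set_def)

text \<open>As long as a vertex of \<open>Z\<close> is missing, leastness of \<open>Z\<close> shows
  that the set built so far is not closed, so it attracts a new vertex, which lies in
  \<open>Z\<close> because \<open>Z\<close> is closed.\<close>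

lemma attraction_enumeration:
  fixes T :: "'a set set"
  assumes H: "hypergraph U T" and Y: "Y \<subseteq> U" and Z: "Z = hclosure U T Y"
  obtains z :: "nat \<Rightarrow> 'a" where "bij_betw z {1..card (Z - Y)} (Z - Y)"
    and "\<And>j. j \<in> {1..card (Z - Y)} \<Longrightarrow> attracts T (Y \<union> z ` {1..<j}) (z j)"
proof -
  let ?P = "\<lambda>n z. inj_on z {1..n} \<and> z ` {1..n} \<subseteq> Z - Y
      \<and> (\<forall>j\<in>{1..n}. attracts T (Y \<union> z ` {1..<j}) (z j))"
  have ZU: "Z \<subseteq> U" and ZC: "closed_set U T Z" and YZ: "Y \<subseteq> Z"
    using hclosure_subset[OF Y] hclosure_least[OF Y] Z by auto
  have fin: "finite (Z - Y)"
    using H ZU by (meson finite_Diff finite_subset hypergraph_def)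
  have "\<exists>z :: nat \<Rightarrow> 'a. ?P n z" if "n \<le> card (Z - Y)" for n
    using that
  proof (induction n)
    case 0
    show ?case by auto
  next
    case (Suc n)
    then obtain z :: "nat \<Rightarrow> 'a" where z: "?P n z" by auto
    let ?S = "Y \<union> z ` {1..n}"
    have "card (z ` {1..n}) = n" using z by (simp add: card_image)
    then have "z ` {1..n} \<noteq> Z - Y" using Suc.prems by force
    then have "\<not> Z \<subseteq> ?S" using z by blast
    then have "\<not> closed_set U T ?S"
      using hclosure_least(3)[OF Y, of T ?S] Z by auto
    then obtain y where y: "y \<in> U" "attracts T ?S y" "y \<notin> ?S"
      using z ZU Y unfolding closed_set_def by blast
    have "attracts T Z y" using y(2) z YZ unfolding attracts_def by blast
    then have yZ: "y \<in> Z" using ZC y(1) unfolding closed_set_def by blast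
    let ?z = "z(Suc n := y)"
    \<comment> \<open>The update at \<open>Suc n\<close> does not touch earlier indices, so the
      attractions already established persist.\<close>
    have im: "?z ` {1..<j} = z ` {1..<j}" if "j \<le> Suc n" for j
      using that by (intro image_cong) auto
    have im': "?z ` {1..Suc n} = insert y (z ` {1..n})"
      by (auto simp: image_iff atLeastAtMostSuc_conv)
    have "inj_on ?z (insert (Suc n) {1..n})"
      using z y(3) im[of "Suc n"] inj_on_cong[of "{1..n}" ?z z]
      by (simp add: atLeastLessThanSuc_atLeastAtMost)
    then have "inj_on ?z {1..Suc n}" by (simp add: atLeastAtMostSuc_conv)
    moreover have "?z ` {1..Suc n} \<subseteq> Z - Y" using im' z yZ y(3) by auto
    moreover have "attracts T (Y \<union> ?z ` {1..<j}) (?z j)" if j: "j \<in> {1..Suc n}" for j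
    proof (cases "j = Suc n")
      case True
      then show ?thesis using y(2) im[of j] by (simp add: atLeastLessThanSuc_atLeastAtMost)
    next
      case False
      then show ?thesis using j z im[of j] by auto
    qed
    ultimately show ?case by blast
  qed
  then obtain z :: "nat \<Rightarrow> 'a" where z: "?P (card (Z - Y)) z" by blast
  then have "card (z ` {1..card (Z - Y)}) = card (Z - Y)" by (simp add: card_image)
  then have "z ` {1..card (Z - Y)} = Z - Y" using z fin by (meson card_subset_eq)
  then show thesis using z that[of z] by (auto simp: bij_betw_def)
qed

text \<open>Each step adds at least one hyperedge, a witness containing the new vertex. Prefixes of
  every length \<open>n\<close> are covered: the closure bound stops early, and uniqueness looks at
  the stage before \<open>z j\<close>.\<close>

lemma num_edges_enumeration:
  assumes H: "hypergraph U T" and inj: "inj_on z {1..p}" and disj: "z ` {1..p} \<inter> Y = {}"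
    and attr: "\<And>j. j \<in> {1..p} \<Longrightarrow> attracts T (Y \<union> z ` {1..<j}) (z j)"
    and "n \<le> p"
  shows "num_edges T Y + n \<le> num_edges T (Y \<union> z ` {1..n})"
  using \<open>n \<le> p\<close>
proof (induction n)
  case 0
  show ?case by simp
next
  case (Suc n)
  let ?S = "Y \<union> z ` {1..n}"
  have "z (Suc n) \<in> z ` {1..p}" using Suc.prems by auto
  then have "z (Suc n) \<notin> Y" using disj by blast
  then have new: "z (Suc n) \<notin> ?S"
    using Suc.prems inj_on_image_mem_iff[OF inj, of "Suc n" "{1..n}"] by auto
  have "{h. witnesses T ?S (z (Suc n)) h} \<noteq> {}"
    using attr[of "Suc n"] Suc.prems
    by (auto simp: attracts_iff_witnesses atLeastLessThanSuc_atLeastAtMost)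
  then have "card {h. witnesses T ?S (z (Suc n)) h} > 0"
    using finite_witnesses[OF H] by (simp add: card_gt_0_iff)
  moreover have "Y \<union> z ` {1..Suc n} = insert (z (Suc n)) ?S"
    by (auto simp: atLeastAtMostSuc_conv)
  ultimately show ?case
    using Suc.IH[OF Suc_leD[OF Suc.prems]] num_edges_insert[OF H new] by simp
qed

lemma card_hclosure_less:
  assumes H: "hypergraph U T" and M: "meager l U T" and X: "X \<subseteq> U" "X \<noteq> {}" "card X \<le> l"
  shows "card (hclosure U T X) < 2 * card X"
proof (rule ccontr)
  let ?Z = "hclosure U T X" and ?m = "card X"
  assume "\<not> ?thesis"
  then have big: "2 * ?m \<le> card ?Z" by simp
  have "finite U" using H by (simp add: hypergraph_def)
  then have fX: "finite X" using X(1) by (rule rev_finite_subset)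
  have "card (?Z - X) = card ?Z - ?m"
    using fX hclosure_least(2)[OF X(1)] by (simp add: card_Diff_subset)
  then have m: "?m \<le> card (?Z - X)" using big by simp
  obtain z where z: "bij_betw z {1..card (?Z - X)} (?Z - X)"
    "\<And>j. j \<in> {1..card (?Z - X)} \<Longrightarrow> attracts T (X \<union> z ` {1..<j}) (z j)"
    using attraction_enumeration[OF H X(1) refl] by blast
  then have inj: "inj_on z {1..card (?Z - X)}" and im: "z ` {1..card (?Z - X)} = ?Z - X"
    by (auto simp: bij_betw_def)
  \<comment> \<open>After exactly \<open>?m\<close> steps there are at most \<open>2 * ?m\<close>
    vertices and at least \<open>?m\<close> hyperedges, which is just enough for density.\<close>
  let ?W = "X \<union> z ` {1..?m}"
  have sub: "z ` {1..?m} \<subseteq> ?Z - X" using m im by (metis atLeastatMost_subset_iff image_mono order_refl)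
  have "card (z ` {1..?m}) = ?m"
    using inj m by (subst card_image) (auto intro: inj_on_subset)
  then have "card ?W \<le> 2 * ?m" using card_Un_le[of X "z ` {1..?m}"] by simp
  moreover have "num_edges T X + ?m \<le> num_edges T ?W"
    using im by (intro num_edges_enumeration[OF H inj _ z(2) m]) auto
  moreover have "?W \<subseteq> U" using sub X(1) hclosure_subset[OF X(1), of T] by blast
  ultimately have "dense_set U T ?W" "card ?W \<le> 2 * l"
    using X by (auto simp: dense_set_def)
  then show False using M by (auto simp: meager_def)
qed

lemma num_edges_Un_closed_less:
  assumes H: "hypergraph U T" and M: "meager l U T" and C: "closed_set U T C"
    and V: "V \<subseteq> U" "V \<noteq> {}" "card V \<le> l"
  shows "num_edges T (C \<union> V) < num_edges T C + card V"
proof (rule ccontr)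
  assume "\<not> ?thesis"
  then have big: "num_edges T C + card V \<le> num_edges T (C \<union> V)" by simp
  have T: "finite T" using H by (rule hypergraph_finite_edges)
  let ?N = "{h \<in> T. h \<subseteq> C \<union> V} - {h \<in> T. h \<subseteq> C}"
  have "card ?N = num_edges T (C \<union> V) - num_edges T C"
    unfolding num_edges_def using T by (intro card_Diff_subset) auto
  then have "card V \<le> card ?N" using big by simp
  \<comment> \<open>Keeping only \<open>card V\<close> of the new hyperedges ensures that the set
    they span stays within the size limit \<open>2 * l\<close> of meagerness.\<close>
  then obtain F where F: "F \<subseteq> ?N" "card F = card V" "finite F"
    by (meson obtain_subset_with_card_n)
  \<comment> \<open>With two vertices of \<open>h\<close> in \<open>C\<close>, the third would be
    attracted by \<open>C\<close> and hence lie in \<open>C\<close>, although \<open>h\<close> is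
    not contained in \<open>C\<close>.\<close>
  have one: "card (h \<inter> C) \<le> 1" if h: "h \<in> F" for h
  proof (rule ccontr)
    assume two: "\<not> card (h \<inter> C) \<le> 1"
    have hT: "h \<in> T" "h \<subseteq> U" "card h = 3" using h F(1) H by (auto simp: hypergraph_def)
    then have fh: "finite h" by (metis card.infinite zero_neq_numeral)
    obtain y where y: "y \<in> h" "y \<notin> C" using h F(1) by auto
    have "card (h - {y}) = 2" using hT(3) y(1) by simp
    moreover have "h \<inter> C \<subseteq> h - {y}" using y(2) by blast
    ultimately have "h \<inter> C = h - {y}" using two fh by (intro card_seteq) auto
    then have "witnesses T C y h" using witnesses_iff[OF H] hT(1) y(1) by blast
    then show False
      using C y hT(2) by (auto simp: closed_set_def attracts_iff_witnesses)
  qed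
  let ?W = "V \<union> (\<Union>h\<in>F. h \<inter> C)"
  have "card (\<Union>h\<in>F. h \<inter> C) \<le> (\<Sum>h\<in>F. card (h \<inter> C))" using F(3) by (rule card_UN_le)
  also have "\<dots> \<le> (\<Sum>h\<in>F. 1)" using one by (rule sum_mono)
  finally have "card ?W \<le> 2 * card V"
    using card_Un_le[of V "\<Union>h\<in>F. h \<inter> C"] F(2) by simp
  moreover have "card V \<le> num_edges T ?W"
    unfolding num_edges_def F(2)[symmetric] using T F(1) by (intro card_mono) auto
  moreover have "?W \<subseteq> U" using V(1) C by (auto simp: closed_set_def)
  ultimately have "dense_set U T ?W" "card ?W \<le> 2 * l"
    using V by (auto simp: dense_set_def)
  then show False using M by (auto simp: meager_def)
qed

theorem theorem2p4p1:
  fixes U :: "'a set" and T :: "'a set set" and k p :: nat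
    and X Y Z :: "'a set" and z0 :: 'a
  assumes "k \<ge> 1"
    and "hypergraph U T"
    and "meager (2 * k) U T"
    and "X \<subseteq> U" and "card X < k"
    and "z0 \<in> U" and "z0 \<notin> hclosure U T X"
    and "Y = hclosure U T X \<union> {z0}"
    and "Z = hclosure U T Y"
    and "p = card (Z - Y)"
  shows "p < k \<and>
    (\<exists>z :: nat \<Rightarrow> 'a. bij_betw z {1..p} (Z - Y) \<and>
      (\<forall>j\<in>{1..p}. attracts T (Y \<union> z ` {1..<j}) (z j) \<and>
         (\<exists>!h. witnesses T (Y \<union> z ` {1..<j}) (z j) h)))"
proof -
  let ?C = "hclosure U T X"
  note H = assms(2)
  have fU: "finite U" using H by (simp add: hypergraph_def)
  have fX: "finite X" using fU assms(4) by (rule rev_finite_subset)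
  have C: "closed_set U T ?C" and XC: "X \<subseteq> ?C" and CU: "?C \<subseteq> U"
    using hclosure_least[OF assms(4)] hclosure_subset[OF assms(4)] by auto
  have YU: "Y \<subseteq> U" using assms(6,8) CU by blast
  have YZ: "Y \<subseteq> Z" and ZU: "Z \<subseteq> U"
    using hclosure_least(2)[OF YU] hclosure_subset[OF YU] assms(9) by auto
  have fY: "finite Y" and fZ: "finite Z"
    using fU YU ZU by (auto intro: rev_finite_subset)
  let ?X = "insert z0 X"
  have XU: "?X \<subseteq> U" using assms(4,6) by blast
  have z0X: "z0 \<notin> X" using assms(7) XC by blast
  \<comment> \<open>\<open>Z\<close> is bounded through the closure of the small set
    \<open>?X\<close>, since \<open>card ?X \<le> k\<close>; the closure bound for \<open>Y\<close>
    itself would only give \<open>p < card Y\<close>.\<close>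
  have "?C \<subseteq> hclosure U T ?X"
    using hclosure_least[OF XU, of T] by (intro hclosure_least(3)[OF assms(4)]) auto
  then have "Y \<subseteq> hclosure U T ?X" using hclosure_least(2)[OF XU, of T] assms(8) by auto
  then have "Z \<subseteq> hclosure U T ?X"
    unfolding assms(9) using hclosure_least[OF XU, of T] by (intro hclosure_least(3)[OF YU])
  moreover have "finite (hclosure U T ?X)"
    using fU hclosure_subset[OF XU] by (rule rev_finite_subset)
  ultimately have "card Z \<le> card (hclosure U T ?X)" by (intro card_mono)
  also have "\<dots> < 2 * card ?X"
    using z0X fX assms(1,5) by (intro card_hclosure_less[OF H assms(3) XU]) auto
  finally have "card Z < 2 * card ?X" .
  moreover have "card ?X \<le> card Y" using fY XC assms(8) by (intro card_mono) auto
  moreover have "card ?X \<le> k" using z0X fX assms(5) by simp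
  moreover have "p = card Z - card Y" unfolding assms(10) using fY YZ by (rule card_Diff_subset)
  \<comment> \<open>The estimate is
    \<open>card Z - card Y < 2 * card ?X - card ?X \<le> k\<close>.\<close>
  ultimately have pk: "p < k" using assms(1) by linarith
  obtain z where z: "bij_betw z {1..p} (Z - Y)"
    and attr: "\<And>j. j \<in> {1..p} \<Longrightarrow> attracts T (Y \<union> z ` {1..<j}) (z j)"
    using attraction_enumeration[OF H YU assms(9)] assms(10) by blast
  have inj: "inj_on z {1..p}" and im: "z ` {1..p} = Z - Y"
    using z by (auto simp: bij_betw_def)
  have "\<exists>!h. witnesses T (Y \<union> z ` {1..<j}) (z j) h" if j: "j \<in> {1..p}" for j
  proof -
    obtain n where n: "j = Suc n" using j by (cases j) auto
    let ?S = "Y \<union> z ` {1..n}" and ?V = "insert z0 (z ` {1..j})"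
    let ?W = "{h. witnesses T ?S (z j) h}"
    have sub: "z ` {1..j} \<subseteq> Z - Y"
      unfolding im[symmetric] using j by (intro image_mono) auto
    have "z j \<in> z ` {1..j}" using j by auto
    then have "z j \<notin> Y" using sub by blast
    then have new: "z j \<notin> ?S"
      using j n inj_on_image_mem_iff[OF inj, of j "{1..n}"] by auto
    have "card ?V \<le> Suc (card (z ` {1..j}))" by (simp add: card_insert_if)
    also have "\<dots> \<le> Suc j" using card_image_le[of "{1..j}" z] by simp
    finally have cV: "card ?V \<le> Suc j" .
    \<comment> \<open>The closed set used is \<open>?C\<close>, with \<open>z0\<close> counted among
      the added vertices. The size condition holds since
      \<open>j + 1 \<le> p + 1 \<le> k\<close>.\<close>
    have "num_edges T (?C \<union> ?V) < num_edges T ?C + card ?V"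
      using cV j pk sub ZU assms(6) by (intro num_edges_Un_closed_less[OF H assms(3) C]) auto
    also have "?C \<union> ?V = insert (z j) ?S"
      unfolding assms(8) n by (auto simp: atLeastAtMostSuc_conv)
    also have "num_edges T \<dots> = num_edges T ?S + card ?W"
      using H new by (rule num_edges_insert)
    finally have "num_edges T ?S + card ?W < num_edges T ?C + Suc j" using cV by linarith
    moreover have "num_edges T Y + n \<le> num_edges T ?S"
      using j n im by (intro num_edges_enumeration[OF H inj _ attr]) auto
    moreover have "num_edges T ?C \<le> num_edges T Y"
      using assms(8) by (intro num_edges_mono hypergraph_finite_edges[OF H]) auto
    \<comment> \<open>The \<open>n = j - 1\<close> earlier steps account for all but one of the at
      most \<open>j\<close> hyperedges by which \<open>insert (z j) ?S\<close> can exceed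
      \<open>?C\<close>, leaving at most one witness.\<close>
    ultimately have "card ?W \<le> Suc 0" using n by linarith
    then have "\<forall>h\<in>?W. \<forall>h'\<in>?W. h = h'"
      using finite_witnesses[OF H, of ?S "z j"] by (simp only: card_le_Suc0_iff_eq)
    moreover have "{1..<j} = {1..n}" using n by auto
    ultimately show ?thesis using attr[OF j] by (auto simp: attracts_iff_witnesses)
  qed
  then show ?thesis using pk z attr by blast
qed

end
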